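(* Let $L\in\mathrm{Lin}\,\mathbb H$ be symmetric, let $P:\mathbb H_{\rm eff}^*\to\mathbb H^*$ be an injective embedding map and $P_0:\mathbb H_0^*\to\mathbb H^*$ a surjective reference map. Let $$L_0:=P_0^TLP_0,\qquad P_1:=P^TP_0,\qquad U:=P_0^TLP-P_0^TP\widetilde L$$ with a symmetric $\widetilde L\in\mathrm{Lin}\,\mathbb H_{\rm eff}$ (extended to $\mathbb H_{\rm eff}^*$), and for $\varepsilon>0$ write $$\widehat L_\varepsilon:=\begin{pmatrix}L_\varepsilon&P_1^T\\P_1&-i\varepsilon\end{pmatrix}\in\mathrm{Lin}(\mathbb H_0\oplus\mathbb H_{\rm eff}),\qquad L_\varepsilon=L_0+i\varepsilon .$$ (i) If the strong limit $$\lim_{\varepsilon\downarrow0}\widehat L_\varepsilon^{-1}\binom U0=\binom{F_0}{F_1}\tag{$\ast$}$$ exists, then the equations $$P_0^TLR+P_0^TPL'=P_0^TLP,\qquad P^TR=0$$ (for linear maps $R:\mathbb H_{\rm eff}^*\to\mathbb H^*$ and $L':\mathbb H_{\rm eff}^*\to\mathbb H_{\rm eff}^*$) are solved by $$R=P_0F_0,\qquad L'=\widetilde L+F_1 .$$ (ii) Relation $(\ast)$ holds with $$F_0=\lim_{\varepsilon\downarrow0}F_{0\varepsilon},\qquad F_1=\lim_{\varepsilon\downarrow0}F_{1\varepsilon},$$ where $$F_{1\varepsilon}=(P_1L_\varepsilon^{-1}P_1^T+i\varepsilon)^{-1}P_1L_\varepsilon^{-1}U,\qquad F_{0\varepsilon}=L_\varepsilon^{-1}(U-P_1^TF_{1\varepsilon}),$$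 if these limits exist.
   Context: Spaces. $\mathrm{Lin}(V,W)$ is the space of continuous linear maps between topological vector spaces and $\mathrm{Lin}\,V=\mathrm{Lin}(V,V)$. $\mathbb H$, $\mathbb H_{\rm eff}$, $\mathbb H_0$ are complex topological vector spaces, each with a complex conjugation $\varphi\mapsto\bar\varphi$ and a continuous symmetric bilinear form $\varphi^T\psi$ that is compatible with conjugation and definite in the sense that $\varphi^*\psi:=\bar\varphi^T\psi$ is a positive definite Hermitian inner product. $\mathbb H^*$ is the continuous dual, with pairing $\varphi^T\psi=\psi^T\varphi$ for $\varphi\in\mathbb H$, $\psi\in\mathbb H^*$; the bilinear form embeds $\mathbb H$ into $\mathbb H^*$ (same for $\mathbb H_{\rm eff},\mathbb H_0$). Operators. $A\in\mathrm{Lin}\,\mathbb H$ is symmetric if $(A\varphi)^T\psi=\varphi^TA\psi$ for all $\varphi,\psi\in\mathbb H$; it is then extended to $\mathbb H^*$ by $\varphi^TA\psi=(A\varphi)^T\psi$ for $\varphi\in\mathbb H,\psi\in\mathbb H^*$ (same for $\mathbb H_{\rm eff}$, $\mathbb H_0$, $\mathbb H_0\oplus\mathbb H_{\rm eff}$). All products are compositions of operators on the dual spaces; thus $U,F_0,F_{0\varepsilon}$ map $\mathbb H_{\rm eff}^*$ to $\mathbb H_0^*$ and $F_1,F_{1\varepsilon}$ map $\mathbb H_{\rm eff}^*$ to $\mathbb H_{\rm eff}^*$. "Strong limit" means pointwise limit of operators. Existence of the limit in (i) includes that $\widehat L_\varepsilon$ is invertible for all sufficiently small $\varepsilon>0$,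 and existence of the limits in (ii) includes that the inverses appearing in $F_{0\varepsilon},F_{1\varepsilon}$ exist for all sufficiently small $\varepsilon>0$. Maps between dual spaces. $P:\mathbb H_{\rm eff}^*\to\mathbb H^*$ is closed, injective, linear, with $\bar P=P$ (it commutes with conjugation) and $P\mathbb H_{\rm eff}\subseteq\mathbb H$. $P_0:\mathbb H_0^*\to\mathbb H^*$ is closed, surjective, linear, with $P_0\mathbb H_0\subseteq\mathbb H$. For $S=P$ or $P_0$ (with $\mathbb K=\mathbb H_{\rm eff}$ or $\mathbb H_0$ respectively) the transpose $S^T$ maps $\mathbb H^*$ to $\mathbb K^*$ and $\mathbb H$ to $\mathbb K$, with $(S^T\psi)^T\eta=\psi^TS\eta$ for $\psi\in\mathbb H^*,\eta\in\mathbb K$ and $(S^T\varphi)^T\chi=\varphi^TS\chi$ for $\varphi\in\mathbb H,\chi\in\mathbb K^*$; $P_1^T=P_0^TP$. *)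

theory Defs
  imports "HOL-Analysis.Analysis"
begin

class complex_tvs = topological_ab_group_add +
  fixes scaleC :: "complex \<Rightarrow> 'a \<Rightarrow> 'a"  (infixr \<open>*\<^sub>C\<close> 75)
  assumes scaleC_add_right: "c *\<^sub>C (x + y) = c *\<^sub>C x + c *\<^sub>C y"
    and scaleC_add_left: "(c + d) *\<^sub>C x = c *\<^sub>C x + d *\<^sub>C x"
    and scaleC_scaleC: "c *\<^sub>C (d *\<^sub>C x) = (c * d) *\<^sub>C x"
    and scaleC_one: "1 *\<^sub>C x = x"
    and tendsto_scaleC_Pair:
      "LIM p (nhds c \<times>\<^sub>F nhds x). fst p *\<^sub>C snd p :> nhds (c *\<^sub>C x)"

interpretation complex_tvs: vector_space "scaleC :: complex \<Rightarrow> 'a \<Rightarrow> 'a::complex_tvs"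
  by unfold_locales (simp_all add: scaleC_add_right scaleC_add_left scaleC_scaleC scaleC_one)

lemma tendsto_scaleC:
  fixes x :: "'a::complex_tvs"
  assumes "(f \<longlongrightarrow> c) F" and "(g \<longlongrightarrow> x) F"
  shows "((\<lambda>t. f t *\<^sub>C g t) \<longlongrightarrow> c *\<^sub>C x) F"
  using filterlim_compose[OF tendsto_scaleC_Pair, of "\<lambda>t. (f t, g t)" c x F] assms
  by (simp add: nhds_prod[symmetric] tendsto_Pair)

instantiation complex :: complex_tvs
begin

definition scaleC_complex :: "complex \<Rightarrow> complex \<Rightarrow> complex"
  where "scaleC_complex c z = c * z"

instance
proof
  fix c x :: complex
  show "LIM p (nhds c \<times>\<^sub>F nhds x). fst p *\<^sub>C snd p :> nhds (c *\<^sub>C x)"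
    unfolding scaleC_complex_def by (intro tendsto_mult filterlim_fst filterlim_snd)
qed (simp_all add: scaleC_complex_def algebra_simps)

end

text \<open>
  \<open>bform \<phi> \<psi>\<close> is \<open>\<phi>\<^sup>T\<psi>\<close>; it is jointly continuous. The conjugation is continuous, so that it
  passes to the continuous dual. Hausdorffness follows from definiteness.
\<close>

class conj_form_space = complex_tvs +
  fixes vconj :: "'a \<Rightarrow> 'a"
    and bform :: "'a \<Rightarrow> 'a \<Rightarrow> complex"
  assumes vconj_vconj: "vconj (vconj x) = x"
    and vconj_add: "vconj (x + y) = vconj x + vconj y"
    and vconj_scaleC: "vconj (c *\<^sub>C x) = cnj c *\<^sub>C vconj x"
    and tendsto_vconj: "LIM y nhds x. vconj y :> nhds (vconj x)"
    and bform_sym: "bform x y = bform y x"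
    and bform_add_left: "bform (x + y) z = bform x z + bform y z"
    and bform_scaleC_left: "bform (c *\<^sub>C x) y = c * bform x y"
    and tendsto_bform_Pair:
      "LIM p (nhds x \<times>\<^sub>F nhds y). bform (fst p) (snd p) :> nhds (bform x y)"
    and bform_vconj: "bform (vconj x) (vconj y) = cnj (bform x y)"
    and bform_pos: "x \<noteq> 0 \<Longrightarrow> Im (bform (vconj x) x) = 0 \<and> 0 < Re (bform (vconj x) x)"

abbreviation clinear :: "('a::complex_tvs \<Rightarrow> 'b::complex_tvs) \<Rightarrow> bool"
  where "clinear \<equiv> Vector_Spaces.linear scaleC scaleC"

lemma clinear_iff:
  "clinear f \<longleftrightarrow> (\<forall>x y. f (x + y) = f x + f y) \<and> (\<forall>c x. f (c *\<^sub>C x) = c *\<^sub>C f x)"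
  by (simp add: Vector_Spaces.linear_iff complex_tvs.vector_space_axioms)

definition Lin :: "('a::complex_tvs \<Rightarrow> 'b::complex_tvs) set"
  where "Lin = {f. clinear f \<and> continuous_on UNIV f}"

typedef (overloaded) 'a cdual = "Lin :: ('a::complex_tvs \<Rightarrow> complex) set"
  morphisms cpair Abs_cdual
proof
  show "(\<lambda>_. 0) \<in> Lin"
    by (simp add: Lin_def clinear_iff scaleC_complex_def)
qed

setup_lifting type_definition_cdual

lemma cpair_add_right: "cpair \<psi> (x + y) = cpair \<psi> x + cpair \<psi> y"
  and cpair_scaleC_right: "cpair \<psi> (c *\<^sub>C x) = c * cpair \<psi> x"
  using cpair[of \<psi>] by (simp_all add: Lin_def clinear_iff scaleC_complex_def)

lemma continuous_on_cpair: "continuous_on UNIV (cpair \<psi>)"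
  using cpair[of \<psi>] by (simp add: Lin_def)

instantiation cdual :: (complex_tvs) ab_group_add
begin

lift_definition zero_cdual :: "'a cdual" is "\<lambda>_. 0"
  by (simp add: Lin_def clinear_iff scaleC_complex_def)
lift_definition plus_cdual :: "'a cdual \<Rightarrow> 'a cdual \<Rightarrow> 'a cdual" is "\<lambda>f g x. f x + g x"
  by (auto simp: Lin_def clinear_iff scaleC_complex_def algebra_simps intro!: continuous_intros)
lift_definition uminus_cdual :: "'a cdual \<Rightarrow> 'a cdual" is "\<lambda>f x. - f x"
  by (auto simp: Lin_def clinear_iff scaleC_complex_def algebra_simps intro!: continuous_intros)
lift_definition minus_cdual :: "'a cdual \<Rightarrow> 'a cdual \<Rightarrow> 'a cdual" is "\<lambda>f g x. f x - g x"
  by (auto simp: Lin_def clinear_iff scaleC_complex_def algebra_simps intro!: continuous_intros)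

instance
  by standard (transfer; force simp: algebra_simps)+

end

text \<open>The dual carries the weak-* topology, i.e. the topology of pointwise convergence.\<close>

instantiation cdual :: (complex_tvs) topological_space
begin

definition open_cdual :: "'a cdual set \<Rightarrow> bool"
  where "open_cdual A \<longleftrightarrow> (\<exists>V. open V \<and> A = cpair -` V)"

instance
proof
  show "open (UNIV :: 'a cdual set)"
    unfolding open_cdual_def by (rule exI[of _ UNIV]) simp
next
  fix S T :: "'a cdual set"
  assume "open S" "open T"
  then obtain V W where "open V" "S = cpair -` V" "open W" "T = cpair -` W"
    unfolding open_cdual_def by blast
  then show "open (S \<inter> T)"
    unfolding open_cdual_def by (intro exI[of _ "V \<inter> W"]) auto
next
  fix K :: "'a cdual set set"
  assume "\<forall>S\<in>K. open S"
  then obtain V where "\<And>S. S \<in> K \<Longrightarrow> open (V S) \<and> S = cpair -` V S"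
    unfolding open_cdual_def by metis
  then show "open (\<Union>K)"
    unfolding open_cdual_def by (intro exI[of _ "\<Union>(V ` K)"]) blast
qed

end

lemma tendsto_fun_iff:
  fixes f :: "'i \<Rightarrow> 'b \<Rightarrow> 'c::topological_space"
  shows "(f \<longlongrightarrow> g) F \<longleftrightarrow> (\<forall>x. ((\<lambda>i. f i x) \<longlongrightarrow> g x) F)"
proof -
  have "(f \<longlongrightarrow> g) F \<longleftrightarrow> limitin (product_topology (\<lambda>_. euclidean) UNIV) f g F"
    by (simp add: euclidean_product_topology)
  then show ?thesis
    by (simp add: limitin_componentwise)
qed

lemma tendsto_cdual_iff:
  "(f \<longlongrightarrow> \<psi>) F \<longleftrightarrow> (\<forall>x. ((\<lambda>i. cpair (f i) x) \<longlongrightarrow> cpair \<psi> x) F)"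
proof -
  have "(f \<longlongrightarrow> \<psi>) F \<longleftrightarrow> ((\<lambda>i. cpair (f i)) \<longlongrightarrow> cpair \<psi>) F"
    unfolding tendsto_def open_cdual_def by auto
  then show ?thesis
    by (simp add: tendsto_fun_iff)
qed

instantiation cdual :: (complex_tvs) complex_tvs
begin

lift_definition scaleC_cdual :: "complex \<Rightarrow> 'a cdual \<Rightarrow> 'a cdual" is "\<lambda>c f x. c * f x"
  by (auto simp: Lin_def clinear_iff scaleC_complex_def algebra_simps intro!: continuous_intros)

lemma cpair_tendsto_ident: "((\<lambda>\<psi>. cpair \<psi> x) \<longlongrightarrow> cpair \<phi> x) (nhds \<phi>)"
  using filterlim_ident[of "nhds \<phi>"] unfolding tendsto_cdual_iff by simp

instance
proof
  fix a b :: "'a cdual" and c :: complex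
  have ev: "((\<lambda>p. cpair (fst p) x) \<longlongrightarrow> cpair a x) (nhds a \<times>\<^sub>F nhds b)"
    "((\<lambda>p. cpair (snd p) x) \<longlongrightarrow> cpair b x) (nhds a \<times>\<^sub>F nhds b)"
    "((\<lambda>p. cpair (snd p) x) \<longlongrightarrow> cpair b x) (nhds c \<times>\<^sub>F nhds b)" for x
    by (rule filterlim_compose[OF cpair_tendsto_ident filterlim_fst]
        filterlim_compose[OF cpair_tendsto_ident filterlim_snd])+
  show "LIM p (nhds a \<times>\<^sub>F nhds b). fst p + snd p :> nhds (a + b)"
    unfolding tendsto_cdual_iff by (auto simp: plus_cdual.rep_eq intro!: tendsto_add ev)
  show "(uminus \<longlongrightarrow> - a) (nhds a)"
    unfolding tendsto_cdual_iff
    by (auto simp: uminus_cdual.rep_eq intro!: tendsto_minus cpair_tendsto_ident)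
  show "LIM p (nhds c \<times>\<^sub>F nhds b). fst p *\<^sub>C snd p :> nhds (c *\<^sub>C b)"
    unfolding tendsto_cdual_iff
    by (auto simp: scaleC_cdual.rep_eq intro!: tendsto_mult ev filterlim_fst)
qed (transfer; force simp: algebra_simps)+

end

instance cdual :: (complex_tvs) t2_space
proof
  fix \<phi> \<psi> :: "'a cdual"
  assume "\<phi> \<noteq> \<psi>"
  then have "cpair \<phi> \<noteq> cpair \<psi>"
    by (simp add: cpair_inject)
  then have "\<exists>x. cpair \<phi> x \<noteq> cpair \<psi> x"
    by (simp only: fun_eq_iff not_all)
  then obtain x where "cpair \<phi> x \<noteq> cpair \<psi> x" ..
  from hausdorff[OF this] obtain A B
    where AB: "open A" "open B" "cpair \<phi> x \<in> A" "cpair \<psi> x \<in> B" "A \<inter> B = {}"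
    by metis
  have "open ((\<lambda>\<xi>. cpair \<xi> x) -` C)" if "open C" for C
  proof -
    have "open ((\<lambda>f. f x) -` C :: ('a \<Rightarrow> complex) set)"
      using that by (intro open_vimage continuous_on_product_coordinates)
    then show ?thesis
      unfolding open_cdual_def by (intro exI[of _ "(\<lambda>f. f x) -` C"]) auto
  qed
  then have "open ((\<lambda>\<xi>. cpair \<xi> x) -` A)" "open ((\<lambda>\<xi>. cpair \<xi> x) -` B)"
    using AB by simp_all
  moreover have "(\<lambda>\<xi>. cpair \<xi> x) -` A \<inter> (\<lambda>\<xi>. cpair \<xi> x) -` B = {}"
    using AB by auto
  moreover have "\<phi> \<in> (\<lambda>\<xi>. cpair \<xi> x) -` A" "\<psi> \<in> (\<lambda>\<xi>. cpair \<xi> x) -` B"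
    using AB by simp_all
  ultimately show "\<exists>A B. open A \<and> open B \<and> \<phi> \<in> A \<and> \<psi> \<in> B \<and> A \<inter> B = {}"
    by (intro exI conjI)
qed

definition symmetric_op :: "('a::conj_form_space \<Rightarrow> 'a) \<Rightarrow> bool"
  where "symmetric_op A \<longleftrightarrow> (\<forall>\<phi> \<psi>. bform (A \<phi>) \<psi> = bform \<phi> (A \<psi>))"

text \<open>\<open>demb\<close> is the embedding \<open>\<phi> \<mapsto> (\<psi> \<mapsto> \<phi>\<^sup>T\<psi>)\<close> of a space into its dual. The extension of a symmetric
  \<open>A\<close> to the dual is \<open>\<phi>\<^sup>TA\<psi> = (A\<phi>)\<^sup>T\<psi>\<close>.\<close>

definition demb :: "'a::conj_form_space \<Rightarrow> 'a cdual"
  where "demb \<phi> = Abs_cdual (bform \<phi>)"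

definition dual_ext :: "('a::conj_form_space \<Rightarrow> 'a) \<Rightarrow> 'a cdual \<Rightarrow> 'a cdual"
  where "dual_ext A \<psi> = Abs_cdual (\<lambda>\<phi>. cpair \<psi> (A \<phi>))"

definition dconj :: "'a::conj_form_space cdual \<Rightarrow> 'a cdual"
  where "dconj \<psi> = Abs_cdual (\<lambda>\<phi>. cnj (cpair \<psi> (vconj \<phi>)))"

lemma continuous_on_UNIV_nhds:
  assumes "\<And>x. (f \<longlongrightarrow> f x) (nhds x)"
  shows "continuous_on UNIV f"
  unfolding continuous_on_def using tendsto_mono[OF at_within_le_nhds assms] by blast

lemma cpair_demb [simp]: "cpair (demb \<phi>) \<psi> = bform \<phi> \<psi>"
proof -
  have "(bform \<phi> \<longlongrightarrow> bform \<phi> y) (nhds y)" for y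
    using filterlim_compose[OF tendsto_bform_Pair, of "\<lambda>t. (\<phi>, t)" \<phi> y "nhds y"]
    by (simp add: nhds_prod[symmetric] tendsto_Pair filterlim_ident)
  then have "continuous_on UNIV (bform \<phi>)"
    by (rule continuous_on_UNIV_nhds)
  moreover have "clinear (bform \<phi>)"
    unfolding clinear_iff bform_sym[of \<phi>]
    by (simp add: bform_add_left bform_scaleC_left scaleC_complex_def)
  ultimately show ?thesis
    by (simp add: demb_def Lin_def Abs_cdual_inverse)
qed

lemma cpair_dual_ext:
  assumes "A \<in> Lin"
  shows "cpair (dual_ext A \<psi>) \<phi> = cpair \<psi> (A \<phi>)"
proof -
  have "continuous_on UNIV (\<lambda>\<phi>. cpair \<psi> (A \<phi>))"
    using assms by (intro continuous_on_compose2[OF continuous_on_cpair[of \<psi>]]) (simp_all add: Lin_def)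
  then have "(\<lambda>\<phi>. cpair \<psi> (A \<phi>)) \<in> Lin"
    using assms
    by (simp add: Lin_def clinear_iff cpair_add_right cpair_scaleC_right scaleC_complex_def)
  then show ?thesis
    by (simp add: dual_ext_def Abs_cdual_inverse)
qed

lemma cpair_dconj: "cpair (dconj \<psi>) \<phi> = cnj (cpair \<psi> (vconj \<phi>))"
proof -
  have "continuous_on UNIV (vconj :: 'a \<Rightarrow> 'a)"
    using tendsto_vconj by (rule continuous_on_UNIV_nhds)
  then have "continuous_on UNIV (\<lambda>\<phi>. cnj (cpair \<psi> (vconj \<phi>)))"
    by (intro continuous_on_cnj continuous_on_compose2[OF continuous_on_cpair[of \<psi>]]) simp_all
  then have "(\<lambda>\<phi>. cnj (cpair \<psi> (vconj \<phi>))) \<in> Lin"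
    by (simp add: Lin_def clinear_iff cpair_add_right cpair_scaleC_right scaleC_complex_def
        vconj_add vconj_scaleC)
  then show ?thesis
    by (simp add: dconj_def Abs_cdual_inverse)
qed

lemma inj_demb: "inj demb"
proof (rule injI, rule ccontr)
  fix x y :: 'a
  assume eq: "demb x = demb y" and "x \<noteq> y"
  have "bform (x - y) z = 0" for z
    using arg_cong[OF eq, of "\<lambda>\<psi>. cpair \<psi> z"] bform_add_left[of "x - y" y z] by simp
  then have "bform (vconj (x - y)) (x - y) = 0"
    by (subst bform_sym)
  with bform_pos[of "x - y"] \<open>x \<noteq> y\<close> show False
    by simp
qed

text \<open>
  If \<open>S\<close> maps (the image of) \<open>'k\<close> into (the image of) \<open>'h\<close>, then \<open>restr S :: 'k \<Rightarrow> 'h\<close> is the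
  restricted map, and the transpose is determined by \<open>(S\<^sup>T\<psi>)\<^sup>T\<eta> = \<psi>\<^sup>T(S\<eta>)\<close> for \<open>\<eta> :: 'k\<close>.
\<close>

definition maps_into_space :: "('k::conj_form_space cdual \<Rightarrow> 'h::conj_form_space cdual) \<Rightarrow> bool"
  where "maps_into_space S \<longleftrightarrow> S ` range demb \<subseteq> range demb"

definition restr :: "('k::conj_form_space cdual \<Rightarrow> 'h::conj_form_space cdual) \<Rightarrow> 'k \<Rightarrow> 'h"
  where "restr S \<eta> = (THE \<phi>. demb \<phi> = S (demb \<eta>))"

definition transpose_map ::
  "('k::conj_form_space cdual \<Rightarrow> 'h::conj_form_space cdual) \<Rightarrow> 'h cdual \<Rightarrow> 'k cdual"
  where "transpose_map S \<psi> = Abs_cdual (\<lambda>\<eta>. cpair \<psi> (restr S \<eta>))"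

text \<open>
  The transpose maps the dual of \<open>'h\<close> into the (continuous) dual of \<open>'k\<close>, and \<open>'h\<close> into \<open>'k\<close>
  with \<open>(S\<^sup>T\<phi>)\<^sup>T\<xi> = \<phi>\<^sup>TS\<xi>\<close> for every \<open>\<xi>\<close> in the dual of \<open>'k\<close>.
\<close>

definition has_transpose :: "('k::conj_form_space cdual \<Rightarrow> 'h::conj_form_space cdual) \<Rightarrow> bool"
  where "has_transpose S \<longleftrightarrow>
    (\<forall>\<psi>. (\<lambda>\<eta>. cpair \<psi> (restr S \<eta>)) \<in> Lin) \<and>
    (\<forall>\<phi>. \<exists>\<kappa>. transpose_map S (demb \<phi>) = demb \<kappa> \<and> (\<forall>\<xi>. cpair \<xi> \<kappa> = cpair (S \<xi>) \<phi>))"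

text \<open>``Closed'' is meant in the sense of closed operators: the graph is closed.\<close>

definition closed_op :: "('a::topological_space \<Rightarrow> 'b::topological_space) \<Rightarrow> bool"
  where "closed_op S \<longleftrightarrow> closed {(x, S x) | x. True}"

definition dual_embedding_map :: "('k::conj_form_space cdual \<Rightarrow> 'h::conj_form_space cdual) \<Rightarrow> bool"
  where "dual_embedding_map P \<longleftrightarrow> clinear P \<and> closed_op P \<and> inj P \<and>
    (\<forall>\<psi>. P (dconj \<psi>) = dconj (P \<psi>)) \<and> maps_into_space P \<and> has_transpose P"

definition dual_reference_map :: "('k::conj_form_space cdual \<Rightarrow> 'h::conj_form_space cdual) \<Rightarrow> bool"
  where "dual_reference_map P\<^sub>0 \<longleftrightarrow> clinear P\<^sub>0 \<and> closed_op P\<^sub>0 \<and> surj P\<^sub>0 \<and>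
    maps_into_space P\<^sub>0 \<and> has_transpose P\<^sub>0"

lemma demb_restr:
  assumes "maps_into_space S"
  shows "demb (restr S \<eta>) = S (demb \<eta>)"
proof -
  from assms obtain \<phi> where \<phi>: "demb \<phi> = S (demb \<eta>)"
    unfolding maps_into_space_def by (metis image_subset_iff rangeE rangeI)
  then have "restr S \<eta> = \<phi>"
    unfolding restr_def by (intro the_equality) (simp_all add: inj_eq[OF inj_demb] flip: \<phi>)
  with \<phi> show ?thesis
    by simp
qed

lemma cpair_transpose_map:
  assumes "has_transpose S"
  shows "cpair (transpose_map S \<psi>) \<eta> = cpair \<psi> (restr S \<eta>)"
  using assms by (simp add: has_transpose_def transpose_map_def Abs_cdual_inverse)

text \<open>Pointwise limit for \<open>\<epsilon> \<rightarrow> 0+\<close>.\<close>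

definition strong_limit ::
  "(real \<Rightarrow> 'a \<Rightarrow> 'b::topological_space) \<Rightarrow> ('a \<Rightarrow> 'b) \<Rightarrow> bool"
  where "strong_limit A B \<longleftrightarrow> (\<forall>x. ((\<lambda>\<epsilon>. A \<epsilon> x) \<longlongrightarrow> B x) (at_right 0))"

definition eventually_invertible :: "(real \<Rightarrow> 'a \<Rightarrow> 'a) \<Rightarrow> bool"
  where "eventually_invertible A \<longleftrightarrow> (\<forall>\<^sub>F \<epsilon> in at_right 0. bij (A \<epsilon>))"

text \<open>\<open>P\<^sub>0\<^sup>TLR + P\<^sub>0\<^sup>TPL' = P\<^sub>0\<^sup>TLP\<close> and \<open>P\<^sup>TR = 0\<close>, for linear \<open>R\<close> and \<open>L'\<close>.\<close>

definition solves_equations ::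
  "('h::conj_form_space \<Rightarrow> 'h) \<Rightarrow> ('e::conj_form_space cdual \<Rightarrow> 'h cdual) \<Rightarrow>
   ('z::conj_form_space cdual \<Rightarrow> 'h cdual) \<Rightarrow>
   ('e cdual \<Rightarrow> 'h cdual) \<Rightarrow> ('e cdual \<Rightarrow> 'e cdual) \<Rightarrow> bool"
  where "solves_equations L P P\<^sub>0 R L' \<longleftrightarrow> clinear R \<and> clinear L' \<and>
    (\<forall>\<eta>. transpose_map P\<^sub>0 (dual_ext L (R \<eta>)) + transpose_map P\<^sub>0 (P (L' \<eta>))
        = transpose_map P\<^sub>0 (dual_ext L (P \<eta>))) \<and>
    (\<forall>\<eta>. transpose_map P (R \<eta>) = 0)"

end

theory Submission
  imports Defs
begin

text \<open>
  The existence of transposes makes \<open>P\<close>, \<open>P\<^sub>0\<close>, \<open>P\<^sup>T\<close>, \<open>P\<^sub>0\<^sup>T\<close> and the extension of \<open>L\<close> continuous for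
  the weak-* topologies. Hence one can pass to the limit \<open>\<epsilon> \<rightarrow> 0\<close> in the two rows of
  \<open>Lhat \<epsilon> (\<xi>, \<zeta>) = (U \<eta>, 0)\<close>; the terms with the factor \<open>\<i> \<epsilon>\<close> vanish because the solutions converge.
  This gives \<open>L\<^sub>0 F\<^sub>0 + P\<^sub>1\<^sup>T F\<^sub>1 = U\<close> and \<open>P\<^sub>1 F\<^sub>0 = 0\<close>, which is the claim of (i). Part (ii) is block
  elimination, \<open>S\<^sub>\<epsilon>\<close> being the negative of the Schur complement of \<open>L\<^sub>\<epsilon>\<close> in \<open>Lhat\<close>.
\<close>

section \<open>Algebra of linear maps and of their pointwise limits\<close>

lemma clinear_add: "clinear f \<Longrightarrow> f (x + y) = f x + f y"
  and clinear_scaleC: "clinear f \<Longrightarrow> f (c *\<^sub>C x) = c *\<^sub>C f x"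
  by (simp_all add: clinear_iff)

lemma clinear_diff: "clinear f \<Longrightarrow> f (x - y) = f x - f y"
  by (metis clinear_add add_diff_cancel diff_add_cancel)

lemma clinear_compose: "clinear f \<Longrightarrow> clinear g \<Longrightarrow> clinear (\<lambda>x. f (g x))"
  by (simp add: clinear_iff)

lemma clinear_plus: "clinear f \<Longrightarrow> clinear g \<Longrightarrow> clinear (\<lambda>x. f x + g x)"
  by (simp add: clinear_iff scaleC_add_right algebra_simps)

lemma clinear_minus: "clinear f \<Longrightarrow> clinear g \<Longrightarrow> clinear (\<lambda>x. f x - g x)"
  by (simp add: clinear_iff complex_tvs.scale_right_diff_distrib algebra_simps)

lemma clinear_scale: "clinear (\<lambda>x. c *\<^sub>C x)"
  by (simp add: clinear_iff scaleC_add_right scaleC_scaleC mult.commute)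

lemma clinear_inv:
  assumes "clinear f" "bij f"
  shows "clinear (inv f)"
  unfolding clinear_iff
proof (intro conjI allI)
  have f: "f (inv f x) = x" "inv f (f y) = y" for x y
    using assms by (simp_all add: bij_is_surj surj_f_inv_f bij_is_inj)
  show "inv f (x + y) = inv f x + inv f y" for x y
    by (metis f clinear_add[OF assms(1)])
  show "inv f (c *\<^sub>C x) = c *\<^sub>C inv f x" for c x
    by (metis f clinear_scaleC[OF assms(1)])
qed

text \<open>Additivity and homogeneity pass to the limit by continuity of the vector space
  operations and uniqueness of limits in a Hausdorff space. Linearity is asked only for small
  \<epsilon>, because \<open>inv\<close> of a map that is not bijective need not be linear.\<close>

lemma strong_limit_clinear:
  fixes B :: "'a::complex_tvs \<Rightarrow> 'b::{complex_tvs, t2_space}"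
  assumes lim: "strong_limit A B" and lin: "\<forall>\<^sub>F \<epsilon> in at_right 0. clinear (A \<epsilon>)"
  shows "clinear B"
  unfolding clinear_iff
proof (intro conjI allI)
  have B: "((\<lambda>\<epsilon>. A \<epsilon> x) \<longlongrightarrow> B x) (at_right 0)" for x
    using lim by (simp add: strong_limit_def)
  show "B (x + y) = B x + B y" for x y
  proof (rule tendsto_unique[OF _ B])
    show "((\<lambda>\<epsilon>. A \<epsilon> (x + y)) \<longlongrightarrow> B x + B y) (at_right 0)"
      by (rule Lim_transform_eventually[OF tendsto_add[OF B[of x] B[of y]]])
        (use lin in eventually_elim, simp add: clinear_add)
  qed simp
  show "B (c *\<^sub>C x) = c *\<^sub>C B x" for c x
  proof (rule tendsto_unique[OF _ B])
    show "((\<lambda>\<epsilon>. A \<epsilon> (c *\<^sub>C x)) \<longlongrightarrow> c *\<^sub>C B x) (at_right 0)"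
      by (rule Lim_transform_eventually[OF tendsto_scaleC[OF tendsto_const[of c] B[of x]]])
        (use lin in eventually_elim, simp add: clinear_scaleC)
  qed simp
qed

section \<open>Linearity and weak-* continuity of extensions and transposes\<close>

lemma clinear_dual_ext: "A \<in> Lin \<Longrightarrow> clinear (dual_ext A)"
  by (simp add: clinear_iff cpair_inject[symmetric] fun_eq_iff cpair_dual_ext
      plus_cdual.rep_eq scaleC_cdual.rep_eq)

lemma clinear_transpose_map: "has_transpose S \<Longrightarrow> clinear (transpose_map S)"
  by (simp add: clinear_iff cpair_inject[symmetric] fun_eq_iff cpair_transpose_map
      plus_cdual.rep_eq scaleC_cdual.rep_eq)

text \<open>Weak-* convergence is tested by evaluation at vectors, and evaluating
  \<open>dual_ext A \<psi>\<close> at \<phi> is evaluating \<psi> at \<open>A \<phi>\<close>. The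
  next lemma rests on the same argument, with \<open>restr S\<close> in place of
  \<open>A\<close>.\<close>

lemma tendsto_dual_ext:
  "A \<in> Lin \<Longrightarrow> (f \<longlongrightarrow> \<psi>) F \<Longrightarrow> ((\<lambda>i. dual_ext A (f i)) \<longlongrightarrow> dual_ext A \<psi>) F"
  by (simp add: tendsto_cdual_iff cpair_dual_ext)

lemma tendsto_transpose_map:
  "has_transpose S \<Longrightarrow> (f \<longlongrightarrow> \<psi>) F \<Longrightarrow>
    ((\<lambda>i. transpose_map S (f i)) \<longlongrightarrow> transpose_map S \<psi>) F"
  by (simp add: tendsto_cdual_iff cpair_transpose_map)

text \<open>Evaluating \<open>S \<xi>\<close> at \<phi> is evaluating \<xi> at the vector \<kappa>
  that represents the transpose of \<open>S\<close> applied to \<phi>. Since \<kappa> does not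
  depend on \<xi>, weak-* convergence is preserved.\<close>

lemma tendsto_has_transpose:
  assumes "has_transpose S" "(f \<longlongrightarrow> \<xi>) F"
  shows "((\<lambda>i. S (f i)) \<longlongrightarrow> S \<xi>) F"
  unfolding tendsto_cdual_iff
proof
  fix \<phi>
  obtain \<kappa> where "\<And>\<xi>. cpair (S \<xi>) \<phi> = cpair \<xi> \<kappa>"
    using assms(1) unfolding has_transpose_def by metis
  then show "((\<lambda>i. cpair (S (f i)) \<phi>) \<longlongrightarrow> cpair (S \<xi>) \<phi>) F"
    using assms(2) by (simp add: tendsto_cdual_iff)
qed

lemma clinear_block_inv:
  fixes A :: "'a::complex_tvs \<Rightarrow> 'b::complex_tvs" and B :: "'c::complex_tvs \<Rightarrow> 'b"
    and C :: "'a \<Rightarrow> 'd::complex_tvs" and D :: "'c \<Rightarrow> 'd" and U :: "'e::complex_tvs \<Rightarrow> 'b"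
  assumes lin: "clinear A" "clinear B" "clinear C" "clinear D" "clinear U"
    and M: "\<And>x y. M (x, y) = (A x + B y, C x + D y)" and bij: "bij M"
  shows "clinear (\<lambda>u. fst (inv M (U u, 0)))" "clinear (\<lambda>u. snd (inv M (U u, 0)))"
proof -
  define X Y where "X = (\<lambda>u. fst (inv M (U u, 0)))" and "Y = (\<lambda>u. snd (inv M (U u, 0)))"
  have M_XY: "M (X u, Y u) = (U u, 0)" for u
    using bij by (simp add: X_def Y_def bij_is_surj surj_f_inv_f)
  \<comment> \<open>Injectivity of \<open>M\<close> reduces linearity of \<open>X\<close> and
    \<open>Y\<close> to superposition: sums and multiples of solutions solve the system whose
    right-hand side is the corresponding sum or multiple.\<close>
  have unique: "X u = x \<and> Y u = y" if "M (x, y) = (U u, 0)" for u x y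
    using injD[OF bij_is_inj[OF bij], of "(X u, Y u)" "(x, y)"] M_XY[of u] that by simp
  have eqs: "A (X u) + B (Y u) = U u" "C (X u) + D (Y u) = 0" for u
    using M_XY[of u] by (simp_all add: M)
  have "M (X u + X v, Y u + Y v) = (U (u + v), 0)" for u v
  proof -
    have "M (X u + X v, Y u + Y v)
        = ((A (X u) + B (Y u)) + (A (X v) + B (Y v)), (C (X u) + D (Y u)) + (C (X v) + D (Y v)))"
      by (simp add: M lin clinear_add algebra_simps)
    then show ?thesis by (simp add: eqs lin clinear_add)
  qed
  moreover have "M (c *\<^sub>C X u, c *\<^sub>C Y u) = (U (c *\<^sub>C u), 0)" for c u
  proof -
    have "M (c *\<^sub>C X u, c *\<^sub>C Y u)
        = (c *\<^sub>C (A (X u) + B (Y u)), c *\<^sub>C (C (X u) + D (Y u)))"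
      by (simp add: M lin clinear_scaleC scaleC_add_right)
    then show ?thesis by (simp add: eqs lin clinear_scaleC)
  qed
  ultimately have "clinear X" "clinear Y"
    unfolding clinear_iff using unique by blast+
  then show "clinear (\<lambda>u. fst (inv M (U u, 0)))" "clinear (\<lambda>u. snd (inv M (U u, 0)))"
    by (simp_all add: X_def Y_def)
qed

text \<open>The first row gives \<open>x = inv A (a - B v)\<close>. Inserting this into the second
  row leaves \<open>S v = C (inv A a) - b\<close>, so invertibility of \<open>A\<close> and
  \<open>S\<close> determines both components.\<close>

lemma block_inv_schur:
  fixes A :: "'a::complex_tvs \<Rightarrow> 'b::complex_tvs" and B :: "'c::complex_tvs \<Rightarrow> 'b"
    and C :: "'a \<Rightarrow> 'd::complex_tvs" and D :: "'c \<Rightarrow> 'd"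
  assumes lin: "clinear A" "clinear C"
    and M: "\<And>x y. M (x, y) = (A x + B y, C x - D y)"
    and S: "\<And>y. S y = C (inv A (B y)) + D y"
    and bij: "bij A" "bij S"
  shows "bij M"
    "inv M (a, 0) = (inv A (a - B (inv S (C (inv A a)))), inv S (C (inv A a)))"
proof -
  \<comment> \<open>The second component for an arbitrary right-hand side \<open>(a, b)\<close>.
    Bijectivity of \<open>M\<close> needs all \<open>b\<close>; the formula for the inverse is the
    case \<open>b = 0\<close>.\<close>
  define y where "y a b = inv S (C (inv A a) - b)" for a b
  have A_iff: "A x = u \<longleftrightarrow> x = inv A u" for x u
    using bij_inv_eq_iff[OF bij(1)] by blast
  have S_iff: "S v = w \<longleftrightarrow> v = inv S w" for v w
    using bij_inv_eq_iff[OF bij(2)] by blast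
  note linv = clinear_inv[OF lin(1) bij(1)]
  have M_iff: "M (x, v) = (a, b) \<longleftrightarrow> (x, v) = (inv A (a - B v), y a b)" for x v a b
  proof -
    have "M (x, v) = (a, b) \<longleftrightarrow> A x = a - B v \<and> C x - D v = b"
      by (simp add: M eq_diff_eq)
    also have "\<dots> \<longleftrightarrow> x = inv A (a - B v) \<and> C (inv A (a - B v)) - D v = b"
      by (auto simp: A_iff)
    also have "C (inv A (a - B v)) - D v = b \<longleftrightarrow> S v = C (inv A a) - b"
      by (auto simp: S clinear_diff[OF linv] clinear_diff[OF lin(2)] algebra_simps)
    finally show ?thesis
      by (simp add: S_iff y_def)
  qed
  have "\<exists>!p. M p = (a, b)" for a b
  proof (rule ex1I[of _ "(inv A (a - B (y a b)), y a b)"])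
    show "M (inv A (a - B (y a b)), y a b) = (a, b)"
      by (simp add: M_iff)
    show "p = (inv A (a - B (y a b)), y a b)" if "M p = (a, b)" for p
      using that by (cases p) (simp add: M_iff)
  qed
  then show bij_M: "bij M"
    by (auto simp: bij_iff)
  show "inv M (a, 0) = (inv A (a - B (inv S (C (inv A a)))), inv S (C (inv A a)))"
    by (rule inv_f_eq[OF bij_is_inj[OF bij_M]]) (simp add: M_iff y_def)
qed

theorem theorem7p1:
  fixes L :: "'h::conj_form_space \<Rightarrow> 'h"
    and Lt :: "'e::conj_form_space \<Rightarrow> 'e"
    and P :: "'e cdual \<Rightarrow> 'h cdual"
    and P\<^sub>0 :: "'z::conj_form_space cdual \<Rightarrow> 'h cdual"
    and L\<^sub>0 :: "'z cdual \<Rightarrow> 'z cdual"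
    and P\<^sub>1 :: "'z cdual \<Rightarrow> 'e cdual"
    and P\<^sub>1T :: "'e cdual \<Rightarrow> 'z cdual"
    and U :: "'e cdual \<Rightarrow> 'z cdual"
    and L\<^sub>\<epsilon> :: "real \<Rightarrow> 'z cdual \<Rightarrow> 'z cdual"
    and Lhat :: "real \<Rightarrow> 'z cdual \<times> 'e cdual \<Rightarrow> 'z cdual \<times> 'e cdual"
    and S\<^sub>\<epsilon> :: "real \<Rightarrow> 'e cdual \<Rightarrow> 'e cdual"
    and F\<^sub>0\<^sub>\<epsilon> :: "real \<Rightarrow> 'e cdual \<Rightarrow> 'z cdual"
    and F\<^sub>1\<^sub>\<epsilon> :: "real \<Rightarrow> 'e cdual \<Rightarrow> 'e cdual"
  assumes L: "L \<in> Lin" "symmetric_op L"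
    and Lt: "Lt \<in> Lin" "symmetric_op Lt"
    and P: "dual_embedding_map P"
    and P\<^sub>0: "dual_reference_map P\<^sub>0"
    and L\<^sub>0: "\<And>\<xi>. L\<^sub>0 \<xi> = transpose_map P\<^sub>0 (dual_ext L (P\<^sub>0 \<xi>))"
    and P\<^sub>1: "\<And>\<xi>. P\<^sub>1 \<xi> = transpose_map P (P\<^sub>0 \<xi>)"
    and P\<^sub>1T: "\<And>\<eta>. P\<^sub>1T \<eta> = transpose_map P\<^sub>0 (P \<eta>)"
    and U: "\<And>\<eta>. U \<eta> =
      transpose_map P\<^sub>0 (dual_ext L (P \<eta>)) - transpose_map P\<^sub>0 (P (dual_ext Lt \<eta>))"
    and L\<^sub>\<epsilon>: "\<And>\<epsilon> \<xi>. L\<^sub>\<epsilon> \<epsilon> \<xi> = L\<^sub>0 \<xi> + (\<i> * of_real \<epsilon>) *\<^sub>C \<xi>"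
    and Lhat: "\<And>\<epsilon> \<xi> \<eta>. Lhat \<epsilon> (\<xi>, \<eta>) =
      (L\<^sub>\<epsilon> \<epsilon> \<xi> + P\<^sub>1T \<eta>, P\<^sub>1 \<xi> - (\<i> * of_real \<epsilon>) *\<^sub>C \<eta>)"
    and S\<^sub>\<epsilon>: "\<And>\<epsilon> \<eta>. S\<^sub>\<epsilon> \<epsilon> \<eta> = P\<^sub>1 (inv (L\<^sub>\<epsilon> \<epsilon>) (P\<^sub>1T \<eta>)) + (\<i> * of_real \<epsilon>) *\<^sub>C \<eta>"
    and F\<^sub>1\<^sub>\<epsilon>: "\<And>\<epsilon> \<eta>. F\<^sub>1\<^sub>\<epsilon> \<epsilon> \<eta> = inv (S\<^sub>\<epsilon> \<epsilon>) (P\<^sub>1 (inv (L\<^sub>\<epsilon> \<epsilon>) (U \<eta>)))"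
    and F\<^sub>0\<^sub>\<epsilon>: "\<And>\<epsilon> \<eta>. F\<^sub>0\<^sub>\<epsilon> \<epsilon> \<eta> = inv (L\<^sub>\<epsilon> \<epsilon>) (U \<eta> - P\<^sub>1T (F\<^sub>1\<^sub>\<epsilon> \<epsilon> \<eta>))"
  shows
    "(\<forall>F\<^sub>0 F\<^sub>1.
        eventually_invertible Lhat \<and>
        strong_limit (\<lambda>\<epsilon> \<eta>. inv (Lhat \<epsilon>) (U \<eta>, 0)) (\<lambda>\<eta>. (F\<^sub>0 \<eta>, F\<^sub>1 \<eta>))
        \<longrightarrow> solves_equations L P P\<^sub>0 (\<lambda>\<eta>. P\<^sub>0 (F\<^sub>0 \<eta>)) (\<lambda>\<eta>. dual_ext Lt \<eta> + F\<^sub>1 \<eta>))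
     \<and>
     (\<forall>F\<^sub>0 F\<^sub>1.
        eventually_invertible L\<^sub>\<epsilon> \<and> eventually_invertible S\<^sub>\<epsilon> \<and>
        strong_limit F\<^sub>0\<^sub>\<epsilon> F\<^sub>0 \<and> strong_limit F\<^sub>1\<^sub>\<epsilon> F\<^sub>1
        \<longrightarrow> eventually_invertible Lhat \<and>
            strong_limit (\<lambda>\<epsilon> \<eta>. inv (Lhat \<epsilon>) (U \<eta>, 0)) (\<lambda>\<eta>. (F\<^sub>0 \<eta>, F\<^sub>1 \<eta>)))"
proof -
  have tr: "has_transpose P" "has_transpose P\<^sub>0" and lin: "clinear P" "clinear P\<^sub>0"
    using P P\<^sub>0 by (simp_all add: dual_embedding_map_def dual_reference_map_def)
  note lin_T = clinear_transpose_map[OF tr(1)] clinear_transpose_map[OF tr(2)]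
  note lin_ext = clinear_dual_ext[OF L(1)] clinear_dual_ext[OF Lt(1)]
  \<comment> \<open>As equations between functions, the definitions can be unfolded also where the
    operators occur unapplied, which exhibits them as compositions.\<close>
  note fun_eqs = ext[of L\<^sub>0, OF L\<^sub>0] ext[of P\<^sub>1, OF P\<^sub>1] ext[of P\<^sub>1T, OF P\<^sub>1T] ext[of U, OF U]
  have lin': "clinear L\<^sub>0" "clinear P\<^sub>1" "clinear P\<^sub>1T" "clinear U"
    unfolding fun_eqs
    using clinear_compose[OF lin_T(2) clinear_compose[OF lin_ext(1) lin(2)]]
      clinear_compose[OF lin_T(1) lin(2)] clinear_compose[OF lin_T(2) lin(1)]
      clinear_minus[OF clinear_compose[OF lin_T(2) clinear_compose[OF lin_ext(1) lin(1)]]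
        clinear_compose[OF lin_T(2) clinear_compose[OF lin(1) lin_ext(2)]]]
    by blast+
  have lin_L\<epsilon>: "clinear (L\<^sub>\<epsilon> \<epsilon>)" for \<epsilon>
    unfolding ext[of "L\<^sub>\<epsilon> \<epsilon>", OF L\<^sub>\<epsilon>] by (rule clinear_plus[OF lin'(1) clinear_scale])
  show ?thesis
  proof (intro conjI allI impI; elim conjE)

    \<comment> \<open>Part (i): passage to the limit in the block system\<close>
    fix F\<^sub>0 :: "'e cdual \<Rightarrow> 'z cdual" and F\<^sub>1 :: "'e cdual \<Rightarrow> 'e cdual"
    assume inv: "eventually_invertible Lhat"
      and lim: "strong_limit (\<lambda>\<epsilon> \<eta>. inv (Lhat \<epsilon>) (U \<eta>, 0)) (\<lambda>\<eta>. (F\<^sub>0 \<eta>, F\<^sub>1 \<eta>))"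
    define X Y where "X = (\<lambda>\<epsilon> \<eta>. fst (inv (Lhat \<epsilon>) (U \<eta>, 0)))"
      and "Y = (\<lambda>\<epsilon> \<eta>. snd (inv (Lhat \<epsilon>) (U \<eta>, 0)))"
    have X: "strong_limit X F\<^sub>0" and Y: "strong_limit Y F\<^sub>1"
      using lim[unfolded strong_limit_def, rule_format, THEN tendsto_fst]
        lim[unfolded strong_limit_def, rule_format, THEN tendsto_snd]
      by (simp_all add: strong_limit_def X_def Y_def)
    \<comment> \<open>The sign is moved into the scalar so that the lower right block is the linear
      map \<open>D\<close> of \<open>clinear_block_inv\<close>.\<close>
    have Lhat': "Lhat \<epsilon> (\<xi>, \<eta>) = (L\<^sub>\<epsilon> \<epsilon> \<xi> + P\<^sub>1T \<eta>, P\<^sub>1 \<xi> + (- (\<i> * of_real \<epsilon>)) *\<^sub>C \<eta>)"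
      for \<epsilon> \<xi> \<eta>
      by (simp add: Lhat complex_tvs.scale_minus_left)
    have ev_lin: "\<forall>\<^sub>F \<epsilon> in at_right 0. clinear (X \<epsilon>)" "\<forall>\<^sub>F \<epsilon> in at_right 0. clinear (Y \<epsilon>)"
      using inv[unfolded eventually_invertible_def]
        clinear_block_inv[OF lin_L\<epsilon> lin'(3) lin'(2) clinear_scale lin'(4) Lhat']
      unfolding X_def Y_def by (auto elim: eventually_mono)
    have lin_F: "clinear F\<^sub>0" "clinear F\<^sub>1"
      by (rule strong_limit_clinear[OF X ev_lin(1)] strong_limit_clinear[OF Y ev_lin(2)])+
    have limits: "L\<^sub>0 (F\<^sub>0 \<eta>) + P\<^sub>1T (F\<^sub>1 \<eta>) = U \<eta>" "P\<^sub>1 (F\<^sub>0 \<eta>) = 0" for \<eta>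
    proof -
      have lX: "((\<lambda>\<epsilon>. X \<epsilon> \<eta>) \<longlongrightarrow> F\<^sub>0 \<eta>) (at_right 0)" and lY: "((\<lambda>\<epsilon>. Y \<epsilon> \<eta>) \<longlongrightarrow> F\<^sub>1 \<eta>) (at_right 0)"
        using X Y by (simp_all add: strong_limit_def)
      \<comment> \<open>Joint continuity of scalar multiplication makes the regularizing terms
        vanish as soon as \<open>Z\<close> converges. The space is left general because the fact
        serves both for \<open>X\<close> in the first row and for \<open>Y\<close> in the
        second.\<close>
      have "((\<lambda>\<epsilon>. \<i> * of_real \<epsilon>) \<longlongrightarrow> \<i> * of_real 0) (at_right 0)"
        by (intro tendsto_intros)
      then have zero: "((\<lambda>\<epsilon>. (\<i> * of_real \<epsilon>) *\<^sub>C Z \<epsilon>) \<longlongrightarrow> 0) (at_right 0)"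
        if "(Z \<longlongrightarrow> \<zeta>) (at_right 0)" for Z :: "real \<Rightarrow> 'b::complex_tvs" and \<zeta>
        using tendsto_scaleC[OF _ that, of "\<lambda>\<epsilon>. \<i> * of_real \<epsilon>" "\<i> * of_real 0"] by simp
      have eqs: "\<forall>\<^sub>F \<epsilon> in at_right 0. L\<^sub>0 (X \<epsilon> \<eta>) + (\<i> * of_real \<epsilon>) *\<^sub>C X \<epsilon> \<eta> + P\<^sub>1T (Y \<epsilon> \<eta>) = U \<eta> \<and>
          P\<^sub>1 (X \<epsilon> \<eta>) = (\<i> * of_real \<epsilon>) *\<^sub>C Y \<epsilon> \<eta>"
        using inv unfolding eventually_invertible_def
      proof eventually_elim
        case (elim \<epsilon>)
        then have "Lhat \<epsilon> (X \<epsilon> \<eta>, Y \<epsilon> \<eta>) = (U \<eta>, 0)"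
          by (simp add: X_def Y_def bij_is_surj surj_f_inv_f)
        then show ?case
          by (simp add: Lhat L\<^sub>\<epsilon>)
      qed
      have "((\<lambda>\<epsilon>. L\<^sub>0 (X \<epsilon> \<eta>) + (\<i> * of_real \<epsilon>) *\<^sub>C X \<epsilon> \<eta> + P\<^sub>1T (Y \<epsilon> \<eta>))
          \<longlongrightarrow> L\<^sub>0 (F\<^sub>0 \<eta>) + 0 + P\<^sub>1T (F\<^sub>1 \<eta>)) (at_right 0)"
        unfolding fun_eqs
        by (intro tendsto_add zero[OF lX] tendsto_transpose_map tr tendsto_dual_ext L(1)
            tendsto_has_transpose[OF tr(1)] tendsto_has_transpose[OF tr(2)] lX lY)
      \<comment> \<open>By the first row the converging expression equals the constant
        \<open>U \<eta>\<close> for small \<epsilon>, and a constant has only itself as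
        limit.\<close>
      then have "((\<lambda>_. U \<eta>) \<longlongrightarrow> L\<^sub>0 (F\<^sub>0 \<eta>) + P\<^sub>1T (F\<^sub>1 \<eta>)) (at_right (0::real))"
        by (rule Lim_transform_eventually[OF tendsto_eq_rhs])
          (simp, use eqs in eventually_elim, simp)
      then show "L\<^sub>0 (F\<^sub>0 \<eta>) + P\<^sub>1T (F\<^sub>1 \<eta>) = U \<eta>"
        by (simp add: tendsto_const_iff)
      have "((\<lambda>\<epsilon>. P\<^sub>1 (X \<epsilon> \<eta>)) \<longlongrightarrow> P\<^sub>1 (F\<^sub>0 \<eta>)) (at_right 0)"
        unfolding fun_eqs
        by (intro tendsto_transpose_map tr tendsto_has_transpose[OF tr(2)] lX)
      \<comment> \<open>The second row turns this into the limit of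
        \<open>(\<i> * of_real \<epsilon>) *\<^sub>C Y \<epsilon> \<eta>\<close>.\<close>
      moreover have "((\<lambda>\<epsilon>. P\<^sub>1 (X \<epsilon> \<eta>)) \<longlongrightarrow> 0) (at_right 0)"
        by (rule Lim_transform_eventually[OF zero[OF lY]]) (use eqs in eventually_elim, simp)
      ultimately show "P\<^sub>1 (F\<^sub>0 \<eta>) = 0"
        by (rule tendsto_unique[rotated]) simp
    qed
    show "solves_equations L P P\<^sub>0 (\<lambda>\<eta>. P\<^sub>0 (F\<^sub>0 \<eta>)) (\<lambda>\<eta>. dual_ext Lt \<eta> + F\<^sub>1 \<eta>)"
      unfolding solves_equations_def
    proof (intro conjI allI)
      show "clinear (\<lambda>\<eta>. P\<^sub>0 (F\<^sub>0 \<eta>))" "clinear (\<lambda>\<eta>. dual_ext Lt \<eta> + F\<^sub>1 \<eta>)"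
        by (rule clinear_compose[OF lin(2) lin_F(1)] clinear_plus[OF lin_ext(2) lin_F(2)])+
      show "transpose_map P (P\<^sub>0 (F\<^sub>0 \<eta>)) = 0" for \<eta>
        using limits(2) by (simp add: P\<^sub>1)
      show "transpose_map P\<^sub>0 (dual_ext L (P\<^sub>0 (F\<^sub>0 \<eta>))) + transpose_map P\<^sub>0 (P (dual_ext Lt \<eta> + F\<^sub>1 \<eta>))
          = transpose_map P\<^sub>0 (dual_ext L (P \<eta>))" for \<eta>
        \<comment> \<open>Expanding by linearity, the contribution of \<open>Lt\<close> to
          \<open>L'\<close> cancels the term subtracted in \<open>U\<close>.\<close>
        using limits(1)[of \<eta>]
        by (simp add: L\<^sub>0 P\<^sub>1T U clinear_add[OF lin(1)] clinear_add[OF lin_T(2)]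
            algebra_simps)
    qed
  next

    \<comment> \<open>Part (ii): the regularized solutions by block elimination\<close>
    fix F\<^sub>0 :: "'e cdual \<Rightarrow> 'z cdual" and F\<^sub>1 :: "'e cdual \<Rightarrow> 'e cdual"
    assume inv: "eventually_invertible L\<^sub>\<epsilon>" "eventually_invertible S\<^sub>\<epsilon>"
      and lim: "strong_limit F\<^sub>0\<^sub>\<epsilon> F\<^sub>0" "strong_limit F\<^sub>1\<^sub>\<epsilon> F\<^sub>1"
    \<comment> \<open>Where both inverses exist, elimination with lower right block
      \<open>- D\<close>, \<open>D\<close> being multiplication by
      \<open>\<i> * of_real \<epsilon>\<close>, yields exactly the two regularized operators.
      Componentwise convergence then gives the limit of the pair.\<close>
    have ev: "\<forall>\<^sub>F \<epsilon> in at_right 0. bij (Lhat \<epsilon>) \<and> (\<forall>\<eta>. inv (Lhat \<epsilon>) (U \<eta>, 0) = (F\<^sub>0\<^sub>\<epsilon> \<epsilon> \<eta>, F\<^sub>1\<^sub>\<epsilon> \<epsilon> \<eta>))"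
      using inv unfolding eventually_invertible_def
    proof eventually_elim
      case (elim \<epsilon>)
      note schur = block_inv_schur[OF lin_L\<epsilon> lin'(2) Lhat S\<^sub>\<epsilon> elim]
      show ?case
        using schur by (simp add: F\<^sub>0\<^sub>\<epsilon> F\<^sub>1\<^sub>\<epsilon>)
    qed
    then show "eventually_invertible Lhat"
      unfolding eventually_invertible_def by eventually_elim simp
    show "strong_limit (\<lambda>\<epsilon> \<eta>. inv (Lhat \<epsilon>) (U \<eta>, 0)) (\<lambda>\<eta>. (F\<^sub>0 \<eta>, F\<^sub>1 \<eta>))"
      unfolding strong_limit_def
    proof
      fix \<eta>
      have "((\<lambda>\<epsilon>. (F\<^sub>0\<^sub>\<epsilon> \<epsilon> \<eta>, F\<^sub>1\<^sub>\<epsilon> \<epsilon> \<eta>)) \<longlongrightarrow> (F\<^sub>0 \<eta>, F\<^sub>1 \<eta>)) (at_right 0)"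
        using lim by (intro tendsto_Pair) (simp_all add: strong_limit_def)
      then show "((\<lambda>\<epsilon>. inv (Lhat \<epsilon>) (U \<eta>, 0)) \<longlongrightarrow> (F\<^sub>0 \<eta>, F\<^sub>1 \<eta>)) (at_right 0)"
        by (rule Lim_transform_eventually) (use ev in eventually_elim, simp)
    qed
  qed
qed

end
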